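(* Let $G$ be a group, $(H,f_G^H)$ a $G$-group, $i\in\{1,2\}$, and let $I$ be a normal subgroup of $H$ such that $\bigcap_{P\in V^i_H(I)}P=I$. Then $V^i_H(I)$ is irreducible if and only if $I$ is a $T_i$-prime ideal. In particular, $Spec^i_G(H)$ is irreducible if and only if $rad^i_G(H)$ is a $T_i$-prime ideal.
   Context: A $G$-group is a group $H$ together with a homomorphism $f_G^H:G\to H$. For $x\in H$, $G(x)$ is the subgroup of $H$ generated by $\{f_G^H(g)xf_G^H(g)^{-1}: g\in G\}$. For subgroups $L,L'$, $[L,L']$ is the subgroup generated by the commutators $ll'l^{-1}l'^{-1}$, $l\in L,l'\in L'$. An ideal of $H$ is a normal subgroup distinct from $H$. An ideal $P$ is $T_1$-prime if for all $x,y\in H$, $[G(x),G(y)]\subset P$ implies $x\in P$ or $y\in P$; it is $T_2$-prime if for all $x,y\in H$, $G(x)\cap G(y)\subset P$ implies $x\in P$ or $y\in P$. $Spec^i_G(H)$ is the set of $T_i$-prime ideals of $H$; for a normal subgroup $I$ of $H$, $V^i_H(I)$ is the set of $P\in Spec^i_G(H)$ with $I\subset P$. $Spec^i_G(H)$ carries the topology (the $T_i$-topology) whose closed sets are the sets $V^i_H(I)$, $I$ a normal subgroup of $H$. $rad^i_G(H)$ is the intersection of all elements of $Spec^i_G(H)$. The intersection of an empty family of subgroups of $H$ is $H$; irreducible spaces are nonempty. *)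

theory Defs
  imports "HOL-Algebra.Generated_Groups" "HOL-Analysis.Abstract_Topology"
begin

text \<open>
  A \<open>G\<close>-group \<open>(H, f)\<close> is an instance of the locale \<open>group_hom G H f\<close>.
\<close>

definition conj_subgroup ::
  "('a, 'm) monoid_scheme \<Rightarrow> ('b, 'n) monoid_scheme \<Rightarrow> ('a \<Rightarrow> 'b) \<Rightarrow> 'b \<Rightarrow> 'b set"
where
  "conj_subgroup G H f x =
     generate H {f g \<otimes>\<^bsub>H\<^esub> x \<otimes>\<^bsub>H\<^esub> inv\<^bsub>H\<^esub> (f g) | g. g \<in> carrier G}"

definition commutator_subgroup :: "('b, 'n) monoid_scheme \<Rightarrow> 'b set \<Rightarrow> 'b set \<Rightarrow> 'b set" where
  "commutator_subgroup H L L' =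
     generate H {l \<otimes>\<^bsub>H\<^esub> l' \<otimes>\<^bsub>H\<^esub> inv\<^bsub>H\<^esub> l \<otimes>\<^bsub>H\<^esub> inv\<^bsub>H\<^esub> l' | l l'. l \<in> L \<and> l' \<in> L'}"

definition group_ideal :: "('b, 'n) monoid_scheme \<Rightarrow> 'b set \<Rightarrow> bool" where
  "group_ideal H P \<longleftrightarrow> P \<lhd> H \<and> P \<noteq> carrier H"

definition T1_prime ::
  "('a, 'm) monoid_scheme \<Rightarrow> ('b, 'n) monoid_scheme \<Rightarrow> ('a \<Rightarrow> 'b) \<Rightarrow> 'b set \<Rightarrow> bool"
where
  "T1_prime G H f P \<longleftrightarrow>
     group_ideal H P \<and>
     (\<forall>x\<in>carrier H. \<forall>y\<in>carrier H.
        commutator_subgroup H (conj_subgroup G H f x) (conj_subgroup G H f y) \<subseteq> P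
        \<longrightarrow> x \<in> P \<or> y \<in> P)"

definition T2_prime ::
  "('a, 'm) monoid_scheme \<Rightarrow> ('b, 'n) monoid_scheme \<Rightarrow> ('a \<Rightarrow> 'b) \<Rightarrow> 'b set \<Rightarrow> bool"
where
  "T2_prime G H f P \<longleftrightarrow>
     group_ideal H P \<and>
     (\<forall>x\<in>carrier H. \<forall>y\<in>carrier H.
        conj_subgroup G H f x \<inter> conj_subgroup G H f y \<subseteq> P
        \<longrightarrow> x \<in> P \<or> y \<in> P)"

text \<open>The index \<open>i\<close> below is only meaningful for \<open>i = 1\<close> and \<open>i = 2\<close>.\<close>

definition T_prime ::
  "nat \<Rightarrow> ('a, 'm) monoid_scheme \<Rightarrow> ('b, 'n) monoid_scheme \<Rightarrow> ('a \<Rightarrow> 'b) \<Rightarrow> 'b set \<Rightarrow> bool"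
where
  "T_prime i G H f P \<longleftrightarrow> (if i = 1 then T1_prime G H f P else T2_prime G H f P)"

definition Spec ::
  "nat \<Rightarrow> ('a, 'm) monoid_scheme \<Rightarrow> ('b, 'n) monoid_scheme \<Rightarrow> ('a \<Rightarrow> 'b) \<Rightarrow> 'b set set"
where
  "Spec i G H f = {P. T_prime i G H f P}"

definition V_Spec ::
  "nat \<Rightarrow> ('a, 'm) monoid_scheme \<Rightarrow> ('b, 'n) monoid_scheme \<Rightarrow> ('a \<Rightarrow> 'b) \<Rightarrow> 'b set \<Rightarrow> 'b set set"
where
  "V_Spec i G H f I = {P \<in> Spec i G H f. I \<subseteq> P}"

definition Inter_subgroups :: "('b, 'n) monoid_scheme \<Rightarrow> 'b set set \<Rightarrow> 'b set" where
  \<comment> \<open>The factor \<open>carrier H\<close> makes the intersection of the empty family equal to \<open>H\<close>.\<close>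
  "Inter_subgroups H \<F> = carrier H \<inter> \<Inter>\<F>"

definition rad ::
  "nat \<Rightarrow> ('a, 'm) monoid_scheme \<Rightarrow> ('b, 'n) monoid_scheme \<Rightarrow> ('a \<Rightarrow> 'b) \<Rightarrow> 'b set"
where
  "rad i G H f = Inter_subgroups H (Spec i G H f)"

definition T_topology ::
  "nat \<Rightarrow> ('a, 'm) monoid_scheme \<Rightarrow> ('b, 'n) monoid_scheme \<Rightarrow> ('a \<Rightarrow> 'b) \<Rightarrow> 'b set topology"
where
  \<comment> \<open>The lemma \<open>closedin_T_topology\<close> below characterizes its closed sets as the \<open>V_Spec i G H f I\<close>.\<close>
  "T_topology i G H f =
     topology (\<lambda>U. \<exists>I. I \<lhd> H \<and> U = Spec i G H f - V_Spec i G H f I)"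

definition irreducible_space :: "'x topology \<Rightarrow> bool" where
  "irreducible_space X \<longleftrightarrow>
     topspace X \<noteq> {} \<and>
     (\<forall>A B. closedin X A \<and> closedin X B \<and> A \<union> B = topspace X
        \<longrightarrow> A = topspace X \<or> B = topspace X)"

context group_hom
begin

lemma T_prime_ideal: "T_prime i G H h P \<Longrightarrow> P \<lhd> H \<and> P \<noteq> carrier H"
  by (auto simp: T_prime_def T1_prime_def T2_prime_def group_ideal_def split: if_splits)

lemma conj_subgroup_subset_normal:
  assumes "I \<lhd> H" "x \<in> I"
  shows "conj_subgroup G H h x \<subseteq> I"
  unfolding conj_subgroup_def
proof (rule H.generate_subgroup_incl)
  show "subgroup I H"
    using assms(1) normal_imp_subgroup by blast
  show "{h g \<otimes>\<^bsub>H\<^esub> x \<otimes>\<^bsub>H\<^esub> inv\<^bsub>H\<^esub> (h g) |g. g \<in> carrier G} \<subseteq> I"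
    using normal.inv_op_closed2[OF assms(1)] assms(2) by auto
qed

lemma commutator_subset_normal:
  assumes "I \<lhd> H" "J \<lhd> H" "L \<subseteq> I" "L' \<subseteq> J"
  shows "commutator_subgroup H L L' \<subseteq> I \<inter> J"
  unfolding commutator_subgroup_def
proof (rule H.generate_subgroup_incl)
  have I: "subgroup I H" and J: "subgroup J H"
    using assms normal_imp_subgroup by blast+
  then show "subgroup (I \<inter> J) H"
    by (rule H.subgroups_Inter_pair)
  show "{l \<otimes>\<^bsub>H\<^esub> l' \<otimes>\<^bsub>H\<^esub> inv\<^bsub>H\<^esub> l \<otimes>\<^bsub>H\<^esub> inv\<^bsub>H\<^esub> l' | l l'. l \<in> L \<and> l' \<in> L'} \<subseteq> I \<inter> J"
  proof safe
    fix l l' assume "l \<in> L" "l' \<in> L'"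
    then have l: "l \<in> I" "l' \<in> J" and c: "l \<in> carrier H" "l' \<in> carrier H"
      using assms subgroup.subset[OF I] subgroup.subset[OF J] by auto
    have "l' \<otimes>\<^bsub>H\<^esub> inv\<^bsub>H\<^esub> l \<otimes>\<^bsub>H\<^esub> inv\<^bsub>H\<^esub> l' \<in> I"
      using normal.inv_op_closed2[OF assms(1) c(2)] subgroup.m_inv_closed[OF I] l by blast
    then have "l \<otimes>\<^bsub>H\<^esub> (l' \<otimes>\<^bsub>H\<^esub> inv\<^bsub>H\<^esub> l \<otimes>\<^bsub>H\<^esub> inv\<^bsub>H\<^esub> l') \<in> I"
      using subgroup.m_closed[OF I] l by blast
    then show "l \<otimes>\<^bsub>H\<^esub> l' \<otimes>\<^bsub>H\<^esub> inv\<^bsub>H\<^esub> l \<otimes>\<^bsub>H\<^esub> inv\<^bsub>H\<^esub> l' \<in> I"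
      using c by (simp add: H.m_assoc)
    have "l \<otimes>\<^bsub>H\<^esub> l' \<otimes>\<^bsub>H\<^esub> inv\<^bsub>H\<^esub> l \<in> J"
      using normal.inv_op_closed2[OF assms(2) c(1)] l by blast
    then show "l \<otimes>\<^bsub>H\<^esub> l' \<otimes>\<^bsub>H\<^esub> inv\<^bsub>H\<^esub> l \<otimes>\<^bsub>H\<^esub> inv\<^bsub>H\<^esub> l' \<in> J"
      using subgroup.m_closed[OF J] subgroup.m_inv_closed[OF J] l by blast
  qed
qed

lemma normal_Inter_carrier:
  assumes "\<And>N. N \<in> \<N> \<Longrightarrow> N \<lhd> H"
  shows "carrier H \<inter> \<Inter>\<N> \<lhd> H"
proof (rule H.normal_invI)
  have sub: "subgroup N H" if "N \<in> \<N>" for N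
    using assms that normal_imp_subgroup by blast
  show "subgroup (carrier H \<inter> \<Inter>\<N>) H"
  proof (rule subgroup.intro)
    show "carrier H \<inter> \<Inter>\<N> \<subseteq> carrier H"
      by blast
    show "\<one>\<^bsub>H\<^esub> \<in> carrier H \<inter> \<Inter>\<N>"
      using subgroup.one_closed[OF sub] by blast
    show "x \<otimes>\<^bsub>H\<^esub> y \<in> carrier H \<inter> \<Inter>\<N>"
      if "x \<in> carrier H \<inter> \<Inter>\<N>" "y \<in> carrier H \<inter> \<Inter>\<N>" for x y
      using that by (auto intro: subgroup.m_closed[OF sub])
    show "inv\<^bsub>H\<^esub> x \<in> carrier H \<inter> \<Inter>\<N>"
      if "x \<in> carrier H \<inter> \<Inter>\<N>" for x
      using that by (auto intro: subgroup.m_inv_closed[OF sub])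
  qed
  show "x \<otimes>\<^bsub>H\<^esub> k \<otimes>\<^bsub>H\<^esub> inv\<^bsub>H\<^esub> x \<in> carrier H \<inter> \<Inter>\<N>"
    if x: "x \<in> carrier H" and k: "k \<in> carrier H \<inter> \<Inter>\<N>" for x k
  proof (intro IntI InterI)
    show "x \<otimes>\<^bsub>H\<^esub> k \<otimes>\<^bsub>H\<^esub> inv\<^bsub>H\<^esub> x \<in> carrier H"
      using x k by simp
    fix N assume "N \<in> \<N>"
    with k show "x \<otimes>\<^bsub>H\<^esub> k \<otimes>\<^bsub>H\<^esub> inv\<^bsub>H\<^esub> x \<in> N"
      by (intro normal.inv_op_closed2[OF assms x]) auto
  qed
qed

lemma V_Spec_Un:
  assumes "I \<lhd> H" "J \<lhd> H"
  shows "V_Spec i G H h I \<union> V_Spec i G H h J = V_Spec i G H h (I \<inter> J)"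
proof -
  have "I \<subseteq> P \<or> J \<subseteq> P" if P: "T_prime i G H h P" and IJ: "I \<inter> J \<subseteq> P" for P
  proof (rule ccontr)
    assume "\<not> (I \<subseteq> P \<or> J \<subseteq> P)"
    then obtain x y where xy: "x \<in> I" "x \<notin> P" "y \<in> J" "y \<notin> P"
      by blast
    then have c: "x \<in> carrier H" "y \<in> carrier H"
      using assms normal_imp_subgroup subgroup.subset by blast+
    let ?x = "conj_subgroup G H h x" and ?y = "conj_subgroup G H h y"
    have s: "?x \<subseteq> I" "?y \<subseteq> J"
      using conj_subgroup_subset_normal assms xy by blast+
    have "commutator_subgroup H ?x ?y \<subseteq> P" "?x \<inter> ?y \<subseteq> P"
      using commutator_subset_normal[OF assms s] s IJ by blast+
    then show False
      using P xy c by (auto simp: T_prime_def T1_prime_def T2_prime_def split: if_splits)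
  qed
  then show ?thesis
    by (auto simp: V_Spec_def Spec_def)
qed

lemma V_Spec_Inter:
  assumes "\<And>I. I \<in> \<I> \<Longrightarrow> I \<lhd> H"
  shows "\<exists>J. J \<lhd> H \<and> V_Spec i G H h J = {P \<in> Spec i G H h. \<forall>I\<in>\<I>. I \<subseteq> P}"
proof -
  let ?N = "{N. N \<lhd> H \<and> \<Union>\<I> \<subseteq> N}"
  have "carrier H \<inter> \<Inter>?N \<lhd> H"
    by (rule normal_Inter_carrier) auto
  moreover have "\<Union>\<I> \<subseteq> carrier H"
    using assms normal_imp_subgroup subgroup.subset by blast
  then have "carrier H \<inter> \<Inter>?N \<subseteq> P \<longleftrightarrow> (\<forall>I\<in>\<I>. I \<subseteq> P)"
    if "P \<in> Spec i G H h" for P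
    using T_prime_ideal[of i P] that by (simp add: Spec_def) blast
  then have "V_Spec i G H h (carrier H \<inter> \<Inter>?N) = {P \<in> Spec i G H h. \<forall>I\<in>\<I>. I \<subseteq> P}"
    unfolding V_Spec_def by blast
  ultimately show ?thesis
    by blast
qed

lemma istopology_T:
  "istopology (\<lambda>U. \<exists>I. I \<lhd> H \<and> U = Spec i G H h - V_Spec i G H h I)"
  unfolding istopology_def
proof (intro conjI allI impI)
  fix S T
  assume "\<exists>I. I \<lhd> H \<and> S = Spec i G H h - V_Spec i G H h I"
    and "\<exists>I. I \<lhd> H \<and> T = Spec i G H h - V_Spec i G H h I"
  then obtain I J where "I \<lhd> H" "J \<lhd> H"
    "S = Spec i G H h - V_Spec i G H h I" "T = Spec i G H h - V_Spec i G H h J"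
    by blast
  then have "S \<inter> T = Spec i G H h - V_Spec i G H h (I \<inter> J)"
    using V_Spec_Un by blast
  moreover have "I \<inter> J \<lhd> H"
    using H.normal_subgroup_intersect \<open>I \<lhd> H\<close> \<open>J \<lhd> H\<close> by blast
  ultimately show "\<exists>I. I \<lhd> H \<and> S \<inter> T = Spec i G H h - V_Spec i G H h I"
    by blast
next
  fix \<K>
  assume *: "\<forall>K\<in>\<K>. \<exists>I. I \<lhd> H \<and> K = Spec i G H h - V_Spec i G H h I"
  let ?I = "{I. I \<lhd> H \<and> Spec i G H h - V_Spec i G H h I \<in> \<K>}"
  obtain J where J: "J \<lhd> H" "V_Spec i G H h J = {P \<in> Spec i G H h. \<forall>I\<in>?I. I \<subseteq> P}"
    using V_Spec_Inter[of ?I i] by blast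
  have "P \<in> \<Union>\<K> \<longleftrightarrow> P \<in> Spec i G H h - V_Spec i G H h J" for P
  proof
    assume "P \<in> \<Union>\<K>"
    then obtain K where K: "K \<in> \<K>" "P \<in> K"
      by blast
    then obtain I where I: "I \<lhd> H" "K = Spec i G H h - V_Spec i G H h I"
      using * by meson
    then have "I \<in> ?I"
      using K by simp
    moreover have "P \<in> Spec i G H h" "\<not> I \<subseteq> P"
      using K I by (simp_all add: V_Spec_def)
    ultimately show "P \<in> Spec i G H h - V_Spec i G H h J"
      unfolding J(2) by blast
  next
    assume "P \<in> Spec i G H h - V_Spec i G H h J"
    then obtain I where "I \<in> ?I" "\<not> I \<subseteq> P" "P \<in> Spec i G H h"
      unfolding J(2) by blast
    then have "Spec i G H h - V_Spec i G H h I \<in> \<K>" "P \<in> Spec i G H h - V_Spec i G H h I"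
      by (simp_all add: V_Spec_def)
    then show "P \<in> \<Union>\<K>"
      by (rule UnionI)
  qed
  then have "\<Union>\<K> = Spec i G H h - V_Spec i G H h J"
    by (rule Set.set_eqI)
  then show "\<exists>I. I \<lhd> H \<and> \<Union>\<K> = Spec i G H h - V_Spec i G H h I"
    using J(1) by (intro exI[of _ J] conjI)
qed

lemma openin_T_topology:
  "openin (T_topology i G H h) U \<longleftrightarrow> (\<exists>I. I \<lhd> H \<and> U = Spec i G H h - V_Spec i G H h I)"
  unfolding T_topology_def topology_inverse'[OF istopology_T] ..

lemma topspace_T_topology: "topspace (T_topology i G H h) = Spec i G H h"
proof -
  have "V_Spec i G H h (carrier H) = {}"
    using T_prime_ideal normal_imp_subgroup subgroup.subset by (fastforce simp: V_Spec_def Spec_def)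
  moreover have "carrier H \<lhd> H"
    using normal_Inter_carrier[of "{}"] by simp
  ultimately have "openin (T_topology i G H h) (Spec i G H h)"
    unfolding openin_T_topology by blast
  moreover have "U \<subseteq> Spec i G H h" if "openin (T_topology i G H h) U" for U
    using that unfolding openin_T_topology by blast
  ultimately show ?thesis
    unfolding topspace_def by blast
qed

lemma closedin_T_topology:
  "closedin (T_topology i G H h) C \<longleftrightarrow> (\<exists>I. I \<lhd> H \<and> C = V_Spec i G H h I)"
proof -
  have sub: "V_Spec i G H h I \<subseteq> Spec i G H h" for I
    by (auto simp: V_Spec_def)
  have "(C \<subseteq> Spec i G H h \<and> Spec i G H h - C = Spec i G H h - V_Spec i G H h I) \<longleftrightarrow>
      C = V_Spec i G H h I" for I
    using sub[of I] by blast
  then show ?thesis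
    unfolding closedin_def topspace_T_topology openin_T_topology by blast
qed

end

end

theory Submission
  imports Defs
begin

text \<open>
  As for the prime spectrum of a ring, the argument compares generic points with prime elements.

  A \<open>T\<^sub>i\<close>-prime ideal \<open>I\<close> is a generic point of \<open>V_Spec i G H f I\<close>: closed sets of primes are
  closed upwards under inclusion, so one that contains the point \<open>I\<close> contains all of
  \<open>V_Spec i G H f I\<close>. When two closed sets cover a space with a generic point, one of them contains
  that point and hence is the whole space (\<open>irreducible_V_Spec_if_T_prime\<close>).

  Conversely, let \<open>V_Spec i G H f I\<close> be irreducible and let \<open>x\<close>, \<open>y\<close> be elements whose
  product \<open>[G(x), G(y)]\<close> (or \<open>G(x) \<inter> G(y)\<close>, according to \<open>i\<close>) lies in \<open>I\<close>. The product then lies in each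
  prime \<open>P\<close> above \<open>I\<close>, which must contain \<open>x\<close> or \<open>y\<close>. The primes containing a
  given element form a closed set (\<open>closedin_primes_containing\<close>), so irreducibility puts one of
  the two elements, say \<open>x\<close>, into all primes above \<open>I\<close>. Since \<open>I\<close> is the intersection of these
  primes, \<open>x \<in> I\<close> (\<open>T_prime_if_irreducible_V_Spec\<close>).

  The assertion on the whole spectrum is the case where \<open>I\<close> is the radical, because every prime
  contains the radical.
\<close>

lemma irreducible_subtopology_iff:
  assumes "S \<subseteq> topspace X"
  shows "irreducible_space (subtopology X S) \<longleftrightarrow>
    S \<noteq> {} \<and> (\<forall>A B. closedin X A \<and> closedin X B \<and> S \<subseteq> A \<union> B \<longrightarrow> S \<subseteq> A \<or> S \<subseteq> B)"
proof -
  have top: "topspace (subtopology X S) = S"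
    using assms by auto
  have "(\<forall>A B. closedin (subtopology X S) A \<and> closedin (subtopology X S) B \<and> A \<union> B = S
            \<longrightarrow> A = S \<or> B = S) \<longleftrightarrow>
        (\<forall>A B. closedin X A \<and> closedin X B \<and> (A \<inter> S) \<union> (B \<inter> S) = S
            \<longrightarrow> A \<inter> S = S \<or> B \<inter> S = S)"
    unfolding closedin_subtopology by blast
  moreover have "(A \<inter> S) \<union> (B \<inter> S) = S \<longleftrightarrow> S \<subseteq> A \<union> B" "A \<inter> S = S \<longleftrightarrow> S \<subseteq> A" for A B
    by blast+
  ultimately show ?thesis
    unfolding irreducible_space_def top by simp
qed

text \<open>
  Both kinds of primes are defined by a product of elements with values in the subsets of \<open>H\<close>.
  The passage from irreducibility to primeness works for any such product, so this common form
  spares a case distinction on \<open>i\<close>.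
\<close>

lemma T_prime_product:
  obtains D where
    "\<And>P. T_prime i G H f P \<longleftrightarrow> group_ideal H P \<and>
       (\<forall>x\<in>carrier H. \<forall>y\<in>carrier H. D x y \<subseteq> P \<longrightarrow> x \<in> P \<or> y \<in> P)"
proof
  show "T_prime i G H f P \<longleftrightarrow> group_ideal H P \<and>
      (\<forall>x\<in>carrier H. \<forall>y\<in>carrier H.
        (if i = 1 then commutator_subgroup H (conj_subgroup G H f x) (conj_subgroup G H f y)
         else conj_subgroup G H f x \<inter> conj_subgroup G H f y) \<subseteq> P \<longrightarrow> x \<in> P \<or> y \<in> P)" for P
    by (simp add: T_prime_def T1_prime_def T2_prime_def)
qed

context group_hom
begin

lemma V_Spec_subset_topspace: "V_Spec i G H h I \<subseteq> topspace (T_topology i G H h)"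
  by (auto simp: V_Spec_def topspace_T_topology)

lemma irreducible_V_Spec_if_T_prime:
  assumes "T_prime i G H h I"
  shows "irreducible_space (subtopology (T_topology i G H h) (V_Spec i G H h I))"
proof -
  have I: "I \<in> V_Spec i G H h I"
    using assms by (simp add: V_Spec_def Spec_def)
  have generic: "V_Spec i G H h I \<subseteq> A" if "closedin (T_topology i G H h) A" "I \<in> A" for A
    using that by (auto simp: closedin_T_topology V_Spec_def)
  show ?thesis
    unfolding irreducible_subtopology_iff[OF V_Spec_subset_topspace] using I generic by blast
qed

text \<open>A prime contains \<open>x\<close> if and only if it contains the normal closure of \<open>x\<close>.\<close>

lemma closedin_primes_containing:
  assumes "x \<in> carrier H"
  shows "closedin (T_topology i G H h) {P \<in> Spec i G H h. x \<in> P}"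
proof -
  let ?N = "carrier H \<inter> \<Inter>{N. N \<lhd> H \<and> x \<in> N}"
  have "?N \<lhd> H"
    by (rule normal_Inter_carrier) auto
  moreover have "x \<in> P \<longleftrightarrow> ?N \<subseteq> P" if "P \<in> Spec i G H h" for P
    using T_prime_ideal[of i P] that assms by (simp add: Spec_def) blast
  then have "{P \<in> Spec i G H h. x \<in> P} = V_Spec i G H h ?N"
    unfolding V_Spec_def by blast
  ultimately show ?thesis
    unfolding closedin_T_topology by blast
qed

lemma T_prime_if_irreducible_V_Spec:
  assumes "I \<lhd> H" and Inter: "Inter_subgroups H (V_Spec i G H h I) = I"
    and "irreducible_space (subtopology (T_topology i G H h) (V_Spec i G H h I))"
  shows "T_prime i G H h I"
proof -
  let ?V = "V_Spec i G H h I"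
  have nonempty: "?V \<noteq> {}"
    and irred: "\<And>A B. closedin (T_topology i G H h) A \<Longrightarrow> closedin (T_topology i G H h) B \<Longrightarrow>
      ?V \<subseteq> A \<union> B \<Longrightarrow> ?V \<subseteq> A \<or> ?V \<subseteq> B"
    using assms(3) unfolding irreducible_subtopology_iff[OF V_Spec_subset_topspace] by blast+
  obtain D where D: "\<And>P. T_prime i G H h P \<longleftrightarrow> group_ideal H P \<and>
      (\<forall>x\<in>carrier H. \<forall>y\<in>carrier H. D x y \<subseteq> P \<longrightarrow> x \<in> P \<or> y \<in> P)"
    using T_prime_product[of i G H h] by metis
  obtain P where "T_prime i G H h P" "I \<subseteq> P"
    using nonempty by (auto simp: V_Spec_def Spec_def)
  then have "I \<noteq> carrier H"
    using T_prime_ideal[of i P] normal_imp_subgroup subgroup.subset by blast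
  then have "group_ideal H I"
    using \<open>I \<lhd> H\<close> by (simp add: group_ideal_def)
  moreover have "x \<in> I \<or> y \<in> I"
    if xy: "x \<in> carrier H" "y \<in> carrier H" and "D x y \<subseteq> I" for x y
  proof -
    have "?V \<subseteq> {P \<in> Spec i G H h. x \<in> P} \<union> {P \<in> Spec i G H h. y \<in> P}"
    proof
      fix P assume "P \<in> ?V"
      then have "T_prime i G H h P" "P \<in> Spec i G H h" "D x y \<subseteq> P"
        using \<open>D x y \<subseteq> I\<close> by (auto simp: V_Spec_def Spec_def)
      then show "P \<in> {P \<in> Spec i G H h. x \<in> P} \<union> {P \<in> Spec i G H h. y \<in> P}"
        using xy D[of P] by blast
    qed
    then have "?V \<subseteq> {P \<in> Spec i G H h. x \<in> P} \<or> ?V \<subseteq> {P \<in> Spec i G H h. y \<in> P}"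
      using xy by (intro irred closedin_primes_containing)
    then have "x \<in> Inter_subgroups H ?V \<or> y \<in> Inter_subgroups H ?V"
      using xy unfolding Inter_subgroups_def by blast
    then show ?thesis
      unfolding Inter .
  qed
  ultimately show ?thesis
    unfolding D by blast
qed

lemma irreducible_V_Spec_iff_T_prime:
  assumes "I \<lhd> H" "Inter_subgroups H (V_Spec i G H h I) = I"
  shows "irreducible_space (subtopology (T_topology i G H h) (V_Spec i G H h I))
    \<longleftrightarrow> T_prime i G H h I"
  using T_prime_if_irreducible_V_Spec[OF assms] irreducible_V_Spec_if_T_prime by blast

lemma normal_rad: "rad i G H h \<lhd> H"
  unfolding rad_def Inter_subgroups_def
  by (rule normal_Inter_carrier) (simp add: Spec_def T_prime_ideal)

lemma V_Spec_rad: "V_Spec i G H h (rad i G H h) = Spec i G H h"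
  by (auto simp: V_Spec_def rad_def Inter_subgroups_def)

lemma irreducible_Spec_iff_T_prime_rad:
  "irreducible_space (T_topology i G H h) \<longleftrightarrow> T_prime i G H h (rad i G H h)"
proof -
  have "Inter_subgroups H (V_Spec i G H h (rad i G H h)) = rad i G H h"
    unfolding V_Spec_rad by (simp add: rad_def)
  moreover have "subtopology (T_topology i G H h) (Spec i G H h) = T_topology i G H h"
    by (metis subtopology_topspace topspace_T_topology)
  ultimately show ?thesis
    using irreducible_V_Spec_iff_T_prime[OF normal_rad, of i i] by (simp add: V_Spec_rad)
qed

end

theorem proposition2p5:
  fixes G :: "('a, 'm) monoid_scheme" and H :: "('b, 'n) monoid_scheme"
    and f :: "'a \<Rightarrow> 'b" and i :: nat
  assumes "group_hom G H f" and "i \<in> {1, 2}"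
  shows "(\<forall>I. I \<lhd> H \<and> Inter_subgroups H (V_Spec i G H f I) = I \<longrightarrow>
            (irreducible_space (subtopology (T_topology i G H f) (V_Spec i G H f I))
               \<longleftrightarrow> T_prime i G H f I)) \<and>
         (irreducible_space (T_topology i G H f) \<longleftrightarrow> T_prime i G H f (rad i G H f))"
proof -
  interpret group_hom G H f
    by (rule assms(1))
  show ?thesis
    using irreducible_V_Spec_iff_T_prime irreducible_Spec_iff_T_prime_rad by blast
qed

end
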